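(* Let $n$ be a positive integer, let $R$ be a ring and let $S$ be a multiplicatively closed subset of $R$. If $R$ is an $n$-OAF-ring, then $S^{-1}R$ is an $n$-OAF-ring. In particular, if $R$ is an $n$-OAF-ring, then $R_M$ is an $n$-OAF-ring for every maximal ideal $M$ of $R$.
   Context: All rings are commutative with $1\neq 0$. A nonempty subset $S\subseteq R$ is multiplicatively closed if $0\notin S$, $1\in S$ and $ab\in S$ for all $a,b\in S$. A proper ideal $I$ of a ring $R$ is an $n$-OA ideal if whenever $a_1a_2\cdots a_{n+1}\in I$ for nonunits $a_1,\ldots,a_{n+1}\in R$, then $a_1a_2\cdots a_n\in I$ or $a_{n+1}\in I$. A ring $R$ is an $n$-OAF-ring if every proper ideal of $R$ is a product of finitely many $n$-OA ideals of $R$. *)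

theory Defs
  imports "HOL-Algebra.Ideal_Product"
begin

locale nonzero_cring = cring +
  assumes one_not_zero: "\<one> \<noteq> \<zero>"

definition mult_closed_set :: "('a, 'm) ring_scheme \<Rightarrow> 'a set \<Rightarrow> bool"
  where "mult_closed_set R S \<longleftrightarrow> submonoid S R \<and> \<zero>\<^bsub>R\<^esub> \<notin> S"

definition proper_ideal :: "('a, 'm) ring_scheme \<Rightarrow> 'a set \<Rightarrow> bool"
  where "proper_ideal R I \<longleftrightarrow> ideal I R \<and> I \<noteq> carrier R"

definition OA_ideal :: "nat \<Rightarrow> ('a, 'm) ring_scheme \<Rightarrow> 'a set \<Rightarrow> bool"
  where "OA_ideal n R I \<longleftrightarrow> proper_ideal R I \<and>
    (\<forall>a \<in> {1..n + 1} \<rightarrow> carrier R - Units R.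
       (\<Otimes>\<^bsub>R\<^esub>i\<in>{1..n + 1}. a i) \<in> I \<longrightarrow> (\<Otimes>\<^bsub>R\<^esub>i\<in>{1..n}. a i) \<in> I \<or> a (n + 1) \<in> I)"

text \<open>The empty product of ideals is the whole ring.\<close>

definition ideal_prod_list :: "('a, 'm) ring_scheme \<Rightarrow> 'a set list \<Rightarrow> 'a set"
  where "ideal_prod_list R Js = foldr (ideal_prod R) Js (carrier R)"

definition OAF_ring :: "nat \<Rightarrow> ('a, 'm) ring_scheme \<Rightarrow> bool"
  where "OAF_ring n R \<longleftrightarrow> nonzero_cring R \<and>
    (\<forall>I. proper_ideal R I \<longrightarrow>
       (\<exists>Js. (\<forall>J \<in> set Js. OA_ideal n R J) \<and> I = ideal_prod_list R Js))"

text \<open>In the localization, the fraction \<open>a/s\<close> is the equivalence class of the pair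
  \<open>(a, s)\<close>, where \<open>a/s = b/t\<close> iff \<open>u (t a - s b) = 0\<close> for some \<open>u \<in> S\<close>. The ring operations
  are defined on classes as the union of the results over all representatives; by the lemmas
  \<open>loc_add_frac\<close> and \<open>loc_mult_frac\<close> below they do not depend on the representatives.\<close>

definition loc_rel :: "('a, 'm) ring_scheme \<Rightarrow> 'a set \<Rightarrow> (('a \<times> 'a) \<times> ('a \<times> 'a)) set"
  where "loc_rel R S = {((a, s), (b, t)). a \<in> carrier R \<and> s \<in> S \<and> b \<in> carrier R \<and> t \<in> S \<and>
    (\<exists>u\<in>S. u \<otimes>\<^bsub>R\<^esub> (t \<otimes>\<^bsub>R\<^esub> a \<ominus>\<^bsub>R\<^esub> s \<otimes>\<^bsub>R\<^esub> b) = \<zero>\<^bsub>R\<^esub>)}"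

definition loc_frac :: "('a, 'm) ring_scheme \<Rightarrow> 'a set \<Rightarrow> 'a \<Rightarrow> 'a \<Rightarrow> ('a \<times> 'a) set"
  where "loc_frac R S a s = loc_rel R S `` {(a, s)}"

definition localization :: "('a, 'm) ring_scheme \<Rightarrow> 'a set \<Rightarrow> ('a \<times> 'a) set ring"
  where "localization R S =
    \<lparr>carrier = (carrier R \<times> S) // loc_rel R S,
     mult = (\<lambda>A B. \<Union>p\<in>A. \<Union>q\<in>B.
       loc_frac R S (fst p \<otimes>\<^bsub>R\<^esub> fst q) (snd p \<otimes>\<^bsub>R\<^esub> snd q)),
     one = loc_frac R S \<one>\<^bsub>R\<^esub> \<one>\<^bsub>R\<^esub>,
     zero = loc_frac R S \<zero>\<^bsub>R\<^esub> \<one>\<^bsub>R\<^esub>,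
     add = (\<lambda>A B. \<Union>p\<in>A. \<Union>q\<in>B.
       loc_frac R S (snd q \<otimes>\<^bsub>R\<^esub> fst p \<oplus>\<^bsub>R\<^esub> snd p \<otimes>\<^bsub>R\<^esub> fst q)
         (snd p \<otimes>\<^bsub>R\<^esub> snd q))\<rparr>"

abbreviation localization_at :: "('a, 'm) ring_scheme \<Rightarrow> 'a set \<Rightarrow> ('a \<times> 'a) set ring"
  where "localization_at R P \<equiv> localization R (carrier R - P)"

context cring
begin

lemma loc_relI:
  assumes "submonoid S R" "a \<in> carrier R" "s \<in> S" "b \<in> carrier R" "t \<in> S"
    and "u \<in> S" "u \<otimes> (t \<otimes> a) = u \<otimes> (s \<otimes> b)"
  shows "((a, s), (b, t)) \<in> loc_rel R S"
proof -
  have c: "s \<in> carrier R" "t \<in> carrier R" "u \<in> carrier R"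
    using assms submonoid.mem_carrier by metis+
  have "u \<otimes> (t \<otimes> a \<ominus> s \<otimes> b) = u \<otimes> (t \<otimes> a) \<ominus> u \<otimes> (s \<otimes> b)"
    using c assms(2,4) by algebra
  also have "\<dots> = \<zero>"
    using c assms(2,4,7) by (simp add: a_minus_def r_neg)
  finally show ?thesis
    using assms unfolding loc_rel_def by blast
qed

lemma loc_relE:
  assumes "submonoid S R" "((a, s), (b, t)) \<in> loc_rel R S"
  obtains u where "a \<in> carrier R" "s \<in> S" "b \<in> carrier R" "t \<in> S" "u \<in> S"
    "u \<otimes> (t \<otimes> a) = u \<otimes> (s \<otimes> b)"
proof -
  obtain u where u: "a \<in> carrier R" "s \<in> S" "b \<in> carrier R" "t \<in> S" "u \<in> S"
    "u \<otimes> (t \<otimes> a \<ominus> s \<otimes> b) = \<zero>"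
    using assms(2) unfolding loc_rel_def by blast
  have c: "s \<in> carrier R" "t \<in> carrier R" "u \<in> carrier R"
    using assms(1) u submonoid.mem_carrier by metis+
  have "u \<otimes> (t \<otimes> a) = u \<otimes> (t \<otimes> a \<ominus> s \<otimes> b) \<oplus> u \<otimes> (s \<otimes> b)"
    using c u(1,3) by algebra
  then have "u \<otimes> (t \<otimes> a) = u \<otimes> (s \<otimes> b)"
    using c u(1,3,6) by simp
  with u that show thesis by blast
qed

lemma loc_rel_equiv:
  assumes S: "submonoid S R"
  shows "equiv (carrier R \<times> S) (loc_rel R S)"
proof (rule equivI)
  have one: "\<one> \<in> S" and cl: "\<And>x y. x \<in> S \<Longrightarrow> y \<in> S \<Longrightarrow> x \<otimes> y \<in> S"
    and sub: "\<And>x. x \<in> S \<Longrightarrow> x \<in> carrier R"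
    using S unfolding submonoid_def by auto
  show "loc_rel R S \<subseteq> (carrier R \<times> S) \<times> (carrier R \<times> S)"
    unfolding loc_rel_def by auto
  show "refl_on (carrier R \<times> S) (loc_rel R S)"
    by (rule refl_onI) (auto intro!: loc_relI[OF S _ _ _ _ one])
  show "sym (loc_rel R S)"
    by (rule symI) (auto elim!: loc_relE[OF S] intro: loc_relI[OF S])
  show "trans (loc_rel R S)"
  proof (rule transI, clarify)
    fix a s b t c r
    assume 1: "((a, s), (b, t)) \<in> loc_rel R S" and 2: "((b, t), (c, r)) \<in> loc_rel R S"
    obtain u where u: "a \<in> carrier R" "s \<in> S" "b \<in> carrier R" "t \<in> S" "u \<in> S"
      "u \<otimes> (t \<otimes> a) = u \<otimes> (s \<otimes> b)" using loc_relE[OF S 1] by metis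
    obtain v where v: "c \<in> carrier R" "r \<in> S" "v \<in> S"
      "v \<otimes> (r \<otimes> b) = v \<otimes> (t \<otimes> c)" using loc_relE[OF S 2] by metis
    note c = u(1,3) v(1) sub[OF u(2)] sub[OF u(4)] sub[OF u(5)] sub[OF v(2)] sub[OF v(3)]
    have "(u \<otimes> v \<otimes> t) \<otimes> (r \<otimes> a) = (v \<otimes> r) \<otimes> (u \<otimes> (t \<otimes> a))"
      using c by algebra
    also have "\<dots> = (u \<otimes> s) \<otimes> (v \<otimes> (r \<otimes> b))"
      unfolding u(6) using c by algebra
    also have "\<dots> = (u \<otimes> v \<otimes> t) \<otimes> (s \<otimes> c)"
      unfolding v(4) using c by algebra
    finally show "((a, s), (c, r)) \<in> loc_rel R S"
      by (intro loc_relI[OF S, of _ _ _ _ "u \<otimes> v \<otimes> t"]) (use u v cl in auto)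
  qed
qed

lemma loc_frac_eq_iff:
  assumes S: "submonoid S R" and "a \<in> carrier R" "s \<in> S" "b \<in> carrier R" "t \<in> S"
  shows "loc_frac R S a s = loc_frac R S b t \<longleftrightarrow>
    (\<exists>u\<in>S. u \<otimes> (t \<otimes> a \<ominus> s \<otimes> b) = \<zero>)"
proof -
  have "loc_frac R S a s = loc_frac R S b t \<longleftrightarrow> ((a, s), (b, t)) \<in> loc_rel R S"
    unfolding loc_frac_def using assms by (intro eq_equiv_class_iff[OF loc_rel_equiv[OF S]]) auto
  then show ?thesis
    using assms by (simp add: loc_rel_def)
qed

lemma loc_UN2:
  assumes S: "submonoid S R" and ab: "a \<in> carrier R" "s \<in> S" "b \<in> carrier R" "t \<in> S"
    and f: "\<And>p q. p \<in> loc_frac R S a s \<Longrightarrow> q \<in> loc_frac R S b t \<Longrightarrow> f p q = C"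
  shows "(\<Union>p\<in>loc_frac R S a s. \<Union>q\<in>loc_frac R S b t. f p q) = C"
proof -
  have "(a, s) \<in> loc_frac R S a s" "(b, t) \<in> loc_frac R S b t"
    unfolding loc_frac_def using ab
    by (simp_all add: equiv_class_self[OF loc_rel_equiv[OF S]] del: Image_singleton_iff)
  then show ?thesis using f by auto
qed

lemma loc_mult_frac:
  assumes S: "submonoid S R" and ab: "a \<in> carrier R" "s \<in> S" "b \<in> carrier R" "t \<in> S"
  shows "loc_frac R S a s \<otimes>\<^bsub>localization R S\<^esub> loc_frac R S b t = loc_frac R S (a \<otimes> b) (s \<otimes> t)"
  unfolding localization_def monoid.simps
proof (rule loc_UN2[OF assms], clarsimp)
  fix a' s' b' t'
  assume "(a', s') \<in> loc_frac R S a s" "(b', t') \<in> loc_frac R S b t"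
  then have 1: "((a, s), (a', s')) \<in> loc_rel R S" and 2: "((b, t), (b', t')) \<in> loc_rel R S"
    by (auto simp: loc_frac_def)
  have cl: "\<And>x y. x \<in> S \<Longrightarrow> y \<in> S \<Longrightarrow> x \<otimes> y \<in> S" and sub: "\<And>x. x \<in> S \<Longrightarrow> x \<in> carrier R"
    using S unfolding submonoid_def by auto
  obtain u where u: "a' \<in> carrier R" "s' \<in> S" "u \<in> S" "u \<otimes> (s' \<otimes> a) = u \<otimes> (s \<otimes> a')"
    using loc_relE[OF S 1] by metis
  obtain v where v: "b' \<in> carrier R" "t' \<in> S" "v \<in> S" "v \<otimes> (t' \<otimes> b) = v \<otimes> (t \<otimes> b')"
    using loc_relE[OF S 2] by metis
  note c = ab(1,3) u(1) v(1) sub[OF ab(2)] sub[OF ab(4)] sub[OF u(2)] sub[OF u(3)]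
    sub[OF v(2)] sub[OF v(3)]
  have "u \<otimes> v \<otimes> (s' \<otimes> t' \<otimes> (a \<otimes> b)) = (u \<otimes> (s' \<otimes> a)) \<otimes> (v \<otimes> (t' \<otimes> b))"
    using c by algebra
  also have "\<dots> = u \<otimes> v \<otimes> (s \<otimes> t \<otimes> (a' \<otimes> b'))"
    unfolding u(4) v(4) using c by algebra
  finally have "((a \<otimes> b, s \<otimes> t), (a' \<otimes> b', s' \<otimes> t')) \<in> loc_rel R S"
    by (intro loc_relI[OF S, of _ _ _ _ "u \<otimes> v"]) (use ab u v cl in auto)
  then show "loc_frac R S (a' \<otimes> b') (s' \<otimes> t') = loc_frac R S (a \<otimes> b) (s \<otimes> t)"
    unfolding loc_frac_def using equiv_class_eq[OF loc_rel_equiv[OF S]] by blast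
qed

lemma loc_add_frac:
  assumes S: "submonoid S R" and ab: "a \<in> carrier R" "s \<in> S" "b \<in> carrier R" "t \<in> S"
  shows "loc_frac R S a s \<oplus>\<^bsub>localization R S\<^esub> loc_frac R S b t =
    loc_frac R S (t \<otimes> a \<oplus> s \<otimes> b) (s \<otimes> t)"
  unfolding localization_def ring.simps
proof (rule loc_UN2[OF assms], clarsimp)
  fix a' s' b' t'
  assume "(a', s') \<in> loc_frac R S a s" "(b', t') \<in> loc_frac R S b t"
  then have 1: "((a, s), (a', s')) \<in> loc_rel R S" and 2: "((b, t), (b', t')) \<in> loc_rel R S"
    by (auto simp: loc_frac_def)
  have cl: "\<And>x y. x \<in> S \<Longrightarrow> y \<in> S \<Longrightarrow> x \<otimes> y \<in> S" and sub: "\<And>x. x \<in> S \<Longrightarrow> x \<in> carrier R"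
    using S unfolding submonoid_def by auto
  obtain u where u: "a' \<in> carrier R" "s' \<in> S" "u \<in> S" "u \<otimes> (s' \<otimes> a) = u \<otimes> (s \<otimes> a')"
    using loc_relE[OF S 1] by metis
  obtain v where v: "b' \<in> carrier R" "t' \<in> S" "v \<in> S" "v \<otimes> (t' \<otimes> b) = v \<otimes> (t \<otimes> b')"
    using loc_relE[OF S 2] by metis
  note c = ab(1,3) u(1) v(1) sub[OF ab(2)] sub[OF ab(4)] sub[OF u(2)] sub[OF u(3)]
    sub[OF v(2)] sub[OF v(3)]
  have "u \<otimes> v \<otimes> (s' \<otimes> t' \<otimes> (t \<otimes> a \<oplus> s \<otimes> b)) =
      (v \<otimes> t \<otimes> t') \<otimes> (u \<otimes> (s' \<otimes> a)) \<oplus> (u \<otimes> s \<otimes> s') \<otimes> (v \<otimes> (t' \<otimes> b))"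
    using c by algebra
  also have "\<dots> = u \<otimes> v \<otimes> (s \<otimes> t \<otimes> (t' \<otimes> a' \<oplus> s' \<otimes> b'))"
    unfolding u(4) v(4) using c by algebra
  finally have "((t \<otimes> a \<oplus> s \<otimes> b, s \<otimes> t), (t' \<otimes> a' \<oplus> s' \<otimes> b', s' \<otimes> t')) \<in> loc_rel R S"
    by (intro loc_relI[OF S, of _ _ _ _ "u \<otimes> v"]) (use c ab u v cl in auto)
  then show "loc_frac R S (t' \<otimes> a' \<oplus> s' \<otimes> b') (s' \<otimes> t') = loc_frac R S (t \<otimes> a \<oplus> s \<otimes> b) (s \<otimes> t)"
    unfolding loc_frac_def using equiv_class_eq[OF loc_rel_equiv[OF S]] by blast
qed

lemma mult_closed_set_compl_maximalideal:
  assumes "maximalideal M R"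
  shows "mult_closed_set R (carrier R - M)"
proof -
  interpret M: primeideal M R
    using assms by (rule maximalideal_prime)
  have "\<one> \<notin> M"
    using M.I_notcarr M.one_imp_carrier by auto
  then show ?thesis
    unfolding mult_closed_set_def submonoid_def using M.I_prime by auto
qed

end

end

theory Submission
  imports Defs "HOL-Algebra.Divisibility"
begin

text \<open>
  Write \<open>E I = {a/s | a \<in> I, s \<in> S}\<close> for the extension of an ideal \<open>I\<close> of \<open>R\<close> to the ring of
  fractions.

  Every ideal \<open>K\<close> of the ring of fractions is the extension of its contraction
  \<open>{a. a/1 \<in> K}\<close> (\<open>extension_contraction\<close>). If \<open>K\<close> is proper, so is the contraction, which is
  therefore a product of \<open>n\<close>-OA ideals \<open>J\<close> of \<open>R\<close>. Extension is multiplicative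
  (\<open>extension_ideal_prod_list\<close>), hence \<open>K\<close> is the product of the ideals \<open>E J\<close>. An \<open>E J\<close> that is the
  whole ring can be dropped from this product (\<open>ideal_prod_list_filter_proper\<close>), and every other
  \<open>E J\<close> is again an \<open>n\<close>-OA ideal (\<open>OA_ideal_extension\<close>).

  The last point is the only one that involves the definition of \<open>n\<close>-OA ideals. If a product of
  \<open>n + 1\<close> nonunits \<open>a\<^sub>i/s\<^sub>i\<close> lies in \<open>E J\<close>, then \<open>u a\<^sub>1 \<dots> a\<^sub>n\<^sub>+\<^sub>1 \<in> J\<close> for some \<open>u \<in> S\<close>. The \<open>a\<^sub>i\<close> are
  nonunits of \<open>R\<close>, because a unit divided by an element of \<open>S\<close> is a unit. A multiple of a nonunit is
  a nonunit, so this also holds for \<open>u a\<^sub>1\<close>; since \<open>n \<ge> 1\<close>, the factor \<open>u a\<^sub>1\<close> is among the first \<open>n\<close>.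
  Hence \<open>u a\<^sub>1 \<dots> a\<^sub>n \<in> J\<close> or \<open>a\<^sub>n\<^sub>+\<^sub>1 \<in> J\<close>, and dividing by elements of \<open>S\<close> gives the claim.
\<close>

section \<open>The ring of fractions\<close>

locale ring_of_fractions = cring +
  fixes S :: "'a set"
  assumes mult_closed_set: "mult_closed_set R S"
begin

abbreviation L :: "('a \<times> 'a) set ring"
  where "L \<equiv> localization R S"

abbreviation frac :: "'a \<Rightarrow> 'a \<Rightarrow> ('a \<times> 'a) set"
  where "frac \<equiv> loc_frac R S"

lemma submonoid_S: "submonoid S R" and zero_notin_S: "\<zero> \<notin> S"
  using mult_closed_set unfolding mult_closed_set_def by auto

lemma S_carrier [simp]: "s \<in> S \<Longrightarrow> s \<in> carrier R"
  using submonoid_S submonoid.mem_carrier by metis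

lemma S_one [simp]: "\<one> \<in> S"
  using submonoid_S submonoid.one_closed by metis

lemma S_mult [simp]: "s \<in> S \<Longrightarrow> t \<in> S \<Longrightarrow> s \<otimes> t \<in> S"
  using submonoid_S submonoid.m_closed by metis

lemma carrier_L_iff: "x \<in> carrier L \<longleftrightarrow> (\<exists>a\<in>carrier R. \<exists>s\<in>S. x = frac a s)"
  unfolding localization_def loc_frac_def quotient_def by auto

lemma frac_closed [simp]: "a \<in> carrier R \<Longrightarrow> s \<in> S \<Longrightarrow> frac a s \<in> carrier L"
  unfolding carrier_L_iff by blast

lemma frac_cases:
  assumes "x \<in> carrier L"
  obtains a s where "a \<in> carrier R" "s \<in> S" "x = frac a s"
  using assms unfolding carrier_L_iff by blast

lemma frac_eqI:
  assumes "t \<otimes> a = s \<otimes> b" "a \<in> carrier R" "s \<in> S" "b \<in> carrier R" "t \<in> S"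
  shows "frac a s = frac b t"
proof -
  have "((a, s), (b, t)) \<in> loc_rel R S"
    using assms by (intro loc_relI[OF submonoid_S, of _ _ _ _ \<one>]) auto
  then show ?thesis
    unfolding loc_frac_def using equiv_class_eq[OF loc_rel_equiv[OF submonoid_S]] by blast
qed

lemma frac_eqE:
  assumes "frac a s = frac b t" "a \<in> carrier R" "s \<in> S" "b \<in> carrier R" "t \<in> S"
  obtains u where "u \<in> S" "u \<otimes> (t \<otimes> a) = u \<otimes> (s \<otimes> b)"
proof -
  have "((a, s), (b, t)) \<in> loc_rel R S"
    using assms eq_equiv_class[OF _ loc_rel_equiv[OF submonoid_S]] unfolding loc_frac_def by auto
  then show thesis
    using loc_relE[OF submonoid_S] that by metis
qed

lemmas frac_mult [simp] = loc_mult_frac[OF submonoid_S]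
  and frac_add [simp] = loc_add_frac[OF submonoid_S]

lemma one_L: "\<one>\<^bsub>L\<^esub> = frac \<one> \<one>" and zero_L: "\<zero>\<^bsub>L\<^esub> = frac \<zero> \<one>"
  by (simp_all add: localization_def)

lemma cring_L: "cring L"
proof (rule cringI)
  show "abelian_group L"
  proof (rule abelian_groupI)
    fix x y z
    assume "x \<in> carrier L" "y \<in> carrier L" "z \<in> carrier L"
    then obtain a s b t c r where x: "a \<in> carrier R" "s \<in> S" "x = frac a s"
      "b \<in> carrier R" "t \<in> S" "y = frac b t" "c \<in> carrier R" "r \<in> S" "z = frac c r"
      by (elim frac_cases) metis
    note c = x(1,4,7) S_carrier[OF x(2)] S_carrier[OF x(5)] S_carrier[OF x(8)]
    have "r \<otimes> (t \<otimes> a \<oplus> s \<otimes> b) \<oplus> s \<otimes> t \<otimes> c = t \<otimes> r \<otimes> a \<oplus> s \<otimes> (r \<otimes> b \<oplus> t \<otimes> c)"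
      using c by algebra
    then show "x \<oplus>\<^bsub>L\<^esub> y \<oplus>\<^bsub>L\<^esub> z = x \<oplus>\<^bsub>L\<^esub> (y \<oplus>\<^bsub>L\<^esub> z)"
      using x c by (simp add: m_assoc)
  next
    fix x y
    assume "x \<in> carrier L" "y \<in> carrier L"
    then show "x \<oplus>\<^bsub>L\<^esub> y = y \<oplus>\<^bsub>L\<^esub> x"
      by (elim frac_cases) (auto intro!: frac_eqI simp: m_comm a_comm)
  next
    fix x
    assume "x \<in> carrier L"
    then obtain a s where x: "a \<in> carrier R" "s \<in> S" "x = frac a s"
      by (rule frac_cases)
    have "frac (\<ominus> a) s \<oplus>\<^bsub>L\<^esub> x = frac \<zero> (s \<otimes> s)"
      using x by (simp add: r_minus l_neg)
    also have "\<dots> = \<zero>\<^bsub>L\<^esub>"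
      unfolding zero_L using x by (intro frac_eqI) auto
    finally show "\<exists>y\<in>carrier L. y \<oplus>\<^bsub>L\<^esub> x = \<zero>\<^bsub>L\<^esub>"
      using x by (intro bexI[of _ "frac (\<ominus> a) s"]) auto
  qed (auto elim!: frac_cases simp: zero_L)
  show "comm_monoid L"
  proof (rule comm_monoidI)
    fix x y
    assume "x \<in> carrier L" "y \<in> carrier L"
    then show "x \<otimes>\<^bsub>L\<^esub> y = y \<otimes>\<^bsub>L\<^esub> x"
      by (elim frac_cases) (simp add: m_comm)
  qed (auto elim!: frac_cases simp: one_L m_assoc)
  fix x y z
  assume "x \<in> carrier L" "y \<in> carrier L" "z \<in> carrier L"
  then obtain a s b t c r where x: "a \<in> carrier R" "s \<in> S" "x = frac a s"
    "b \<in> carrier R" "t \<in> S" "y = frac b t" "c \<in> carrier R" "r \<in> S" "z = frac c r"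
    by (elim frac_cases) metis
  note c = x(1,4,7) S_carrier[OF x(2)] S_carrier[OF x(5)] S_carrier[OF x(8)]
  have "s \<otimes> r \<otimes> (t \<otimes> r) \<otimes> ((t \<otimes> a \<oplus> s \<otimes> b) \<otimes> c) =
      s \<otimes> t \<otimes> r \<otimes> (t \<otimes> r \<otimes> (a \<otimes> c) \<oplus> s \<otimes> r \<otimes> (b \<otimes> c))"
    using c by algebra
  then have "frac ((t \<otimes> a \<oplus> s \<otimes> b) \<otimes> c) (s \<otimes> t \<otimes> r) =
      frac (t \<otimes> r \<otimes> (a \<otimes> c) \<oplus> s \<otimes> r \<otimes> (b \<otimes> c)) (s \<otimes> r \<otimes> (t \<otimes> r))"
    using x by (intro frac_eqI) auto
  then show "(x \<oplus>\<^bsub>L\<^esub> y) \<otimes>\<^bsub>L\<^esub> z = x \<otimes>\<^bsub>L\<^esub> z \<oplus>\<^bsub>L\<^esub> y \<otimes>\<^bsub>L\<^esub> z"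
    using x by simp
qed

lemma nonzero_cring_L: "nonzero_cring L"
proof (intro nonzero_cring.intro cring_L nonzero_cring_axioms.intro notI)
  assume "\<one>\<^bsub>L\<^esub> = \<zero>\<^bsub>L\<^esub>"
  then obtain u where "u \<in> S" "u \<otimes> (\<one> \<otimes> \<one>) = u \<otimes> (\<one> \<otimes> \<zero>)"
    unfolding one_L zero_L by (rule frac_eqE) auto
  then show False
    using zero_notin_S by auto
qed

sublocale L: nonzero_cring L
  by (rule nonzero_cring_L)

lemma frac_Units:
  assumes "a \<in> Units R" "s \<in> S"
  shows "frac a s \<in> Units L"
proof -
  have a: "a \<in> carrier R" "inv a \<in> carrier R"
    using assms by auto
  have "s \<otimes> (a \<otimes> inv a) = s"
    using assms by (simp add: Units_r_inv)
  then have eq: "a \<otimes> (s \<otimes> inv a) = s"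
    using m_lcomm[OF a(1) S_carrier[OF assms(2)] a(2)] by metis
  have "frac a s \<otimes>\<^bsub>L\<^esub> frac (s \<otimes> inv a) \<one> = frac s s"
    using a assms(2) by (simp add: eq)
  also have "\<dots> = \<one>\<^bsub>L\<^esub>"
    unfolding one_L using assms(2) by (intro frac_eqI) auto
  finally have "frac a s \<otimes>\<^bsub>L\<^esub> frac (s \<otimes> inv a) \<one> \<in> Units L"
    using L.Units_one_closed by metis
  then show ?thesis
    by (rule L.unit_factor) (use a assms(2) in simp_all)
qed

lemma finprod_S:
  assumes "finite A" "s \<in> A \<rightarrow> S"
  shows "(\<Otimes>i\<in>A. s i) \<in> S"
  using assms
proof (induction A rule: finite_induct)
  case (insert i A)
  then have "s \<in> A \<rightarrow> carrier R" "s i \<in> carrier R"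
    by (auto simp: Pi_iff)
  with insert show ?case by simp
qed simp

lemma finprod_frac:
  assumes "finite A" "a \<in> A \<rightarrow> carrier R" "s \<in> A \<rightarrow> S"
  shows "(\<Otimes>\<^bsub>L\<^esub>i\<in>A. frac (a i) (s i)) = frac (\<Otimes>i\<in>A. a i) (\<Otimes>i\<in>A. s i)"
  using assms
proof (induction A rule: finite_induct)
  case (insert i A)
  then have "(\<lambda>i. frac (a i) (s i)) \<in> A \<rightarrow> carrier L" "s \<in> A \<rightarrow> carrier R" "s i \<in> carrier R"
    by (auto simp: Pi_iff)
  with insert show ?case by (simp add: finprod_S)
qed (simp add: one_L)

section \<open>Extension and contraction of ideals\<close>

definition extension :: "'a set \<Rightarrow> ('a \<times> 'a) set set"
  where "extension I = {frac a s | a s. a \<in> I \<and> s \<in> S}"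

definition contraction :: "('a \<times> 'a) set set \<Rightarrow> 'a set"
  where "contraction K = {a \<in> carrier R. frac a \<one> \<in> K}"

lemma frac_in_extensionI: "a \<in> I \<Longrightarrow> s \<in> S \<Longrightarrow> frac a s \<in> extension I"
  unfolding extension_def by blast

text \<open>Since the representative of a fraction is not unique, the numerator of an element of the
  extension need not lie in \<open>I\<close>; it only does so up to a factor from \<open>S\<close>.\<close>

lemma frac_in_extension_iff:
  assumes I: "ideal I R" and a: "a \<in> carrier R" "s \<in> S"
  shows "frac a s \<in> extension I \<longleftrightarrow> (\<exists>u\<in>S. u \<otimes> a \<in> I)"
proof
  interpret I: ideal I R by (rule I)
  assume "frac a s \<in> extension I"
  then obtain b t where b: "b \<in> I" "t \<in> S" "frac a s = frac b t"
    unfolding extension_def by blast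
  then obtain u where u: "u \<in> S" "u \<otimes> (t \<otimes> a) = u \<otimes> (s \<otimes> b)"
    using a I.Icarr frac_eqE by metis
  have "u \<otimes> t \<otimes> a = u \<otimes> (s \<otimes> b)"
    using a b u by (simp add: m_assoc)
  also have "\<dots> \<in> I"
    using a b u by (simp add: I.I_l_closed)
  finally show "\<exists>u\<in>S. u \<otimes> a \<in> I"
    using b u by (intro bexI[of _ "u \<otimes> t"]) auto
next
  assume "\<exists>u\<in>S. u \<otimes> a \<in> I"
  then obtain u where u: "u \<in> S" "u \<otimes> a \<in> I" by blast
  have "frac a s = frac (u \<otimes> a) (u \<otimes> s)"
    using a u by (intro frac_eqI) (auto simp: m_ac)
  then show "frac a s \<in> extension I"
    using a u frac_in_extensionI by simp
qed

lemma ideal_extension: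
  assumes I: "ideal I R"
  shows "ideal (extension I) L"
proof (rule idealI[OF L.ring_axioms])
  interpret I: ideal I R by (rule I)
  have l_closed: "y \<otimes>\<^bsub>L\<^esub> x \<in> extension I" if "x \<in> extension I" "y \<in> carrier L" for x y
  proof -
    from that obtain a s b t
      where "a \<in> I" "s \<in> S" "x = frac a s" "b \<in> carrier R" "t \<in> S" "y = frac b t"
      unfolding extension_def carrier_L_iff by blast
    then show ?thesis
      by (simp add: I.Icarr I.I_l_closed frac_in_extensionI)
  qed
  have sub: "extension I \<subseteq> carrier L"
    unfolding extension_def using I.Icarr by auto
  show "subgroup (extension I) (add_monoid L)"
  proof (rule L.add.subgroupI)
    show "extension I \<noteq> {}"
      using frac_in_extensionI[OF I.zero_closed S_one] by blast
    show "\<ominus>\<^bsub>L\<^esub> x \<in> extension I" if "x \<in> extension I" for x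
    proof -
      have "\<ominus>\<^bsub>L\<^esub> x = (\<ominus>\<^bsub>L\<^esub> \<one>\<^bsub>L\<^esub>) \<otimes>\<^bsub>L\<^esub> x"
        using that sub by (auto simp: L.l_minus)
      then show ?thesis using l_closed[OF that] by simp
    qed
    show "x \<oplus>\<^bsub>L\<^esub> y \<in> extension I" if "x \<in> extension I" "y \<in> extension I" for x y
    proof -
      from that obtain a s b t
        where "a \<in> I" "s \<in> S" "x = frac a s" "b \<in> I" "t \<in> S" "y = frac b t"
        unfolding extension_def by blast
      then show ?thesis
        using frac_in_extensionI[of "t \<otimes> a \<oplus> s \<otimes> b" I "s \<otimes> t"]
        by (simp add: I.Icarr I.I_l_closed)
    qed
  qed (rule sub)
  show "y \<otimes>\<^bsub>L\<^esub> x \<in> extension I" if "x \<in> extension I" "y \<in> carrier L" for x y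
    using that by (rule l_closed)
  show "x \<otimes>\<^bsub>L\<^esub> y \<in> extension I" if "x \<in> extension I" "y \<in> carrier L" for x y
    using l_closed[OF that] that sub by (simp add: L.m_comm subsetD)
qed

lemma extension_carrier: "extension (carrier R) = carrier L"
  unfolding extension_def using carrier_L_iff by blast

text \<open>A fraction \<open>(i j)/s\<close> factors as \<open>(i/s) (j/1)\<close>, and \<open>(i/s) (j/t)\<close> is again a fraction with numerator
  in the product; sums are handled with a common denominator.\<close>

lemma extension_ideal_prod:
  assumes I: "ideal I R" and J: "ideal J R"
  shows "extension (ideal_prod R I J) = ideal_prod L (extension I) (extension J)"
proof
  interpret I: ideal I R by (rule I)
  interpret J: ideal J R by (rule J)
  interpret E: ideal "extension (ideal_prod R I J)" L
    by (intro ideal_extension ideal_prod_is_ideal I J)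
  have "frac a s \<in> ideal_prod L (extension I) (extension J)"
    if "a \<in> ideal_prod R I J" "s \<in> S" for a s
    using that
  proof (induction a rule: ideal_prod.induct)
    case (prod i j)
    then have "frac i s \<otimes>\<^bsub>L\<^esub> frac j \<one> \<in> ideal_prod L (extension I) (extension J)"
      by (intro ideal_prod.prod frac_in_extensionI) auto
    with prod show ?case by (simp add: I.Icarr J.Icarr)
  next
    case (sum a b)
    have c: "a \<in> carrier R" "b \<in> carrier R"
      using sum ideal_prod_in_carrier[OF I J] by auto
    have "s \<otimes> (s \<otimes> a \<oplus> s \<otimes> b) = s \<otimes> s \<otimes> (a \<oplus> b)"
      using c S_carrier[OF sum.prems] by algebra
    then have "frac (s \<otimes> a \<oplus> s \<otimes> b) (s \<otimes> s) = frac (a \<oplus> b) s"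
      using c sum.prems by (intro frac_eqI) auto
    then have "frac a s \<oplus>\<^bsub>L\<^esub> frac b s = frac (a \<oplus> b) s"
      using c sum.prems by simp
    then show ?case
      using ideal_prod.sum[OF sum.IH(1)[OF sum.prems] sum.IH(2)[OF sum.prems]] by simp
  qed
  then show "extension (ideal_prod R I J) \<subseteq> ideal_prod L (extension I) (extension J)"
    unfolding extension_def[of "ideal_prod R I J"] by blast
  show "ideal_prod L (extension I) (extension J) \<subseteq> extension (ideal_prod R I J)"
  proof
    fix x assume "x \<in> ideal_prod L (extension I) (extension J)"
    then show "x \<in> extension (ideal_prod R I J)"
    proof (induction x rule: ideal_prod.induct)
      case (prod x y)
      then obtain a s b t where "a \<in> I" "s \<in> S" "x = frac a s" "b \<in> J" "t \<in> S" "y = frac b t"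
        unfolding extension_def by blast
      then show ?case
        by (simp add: I.Icarr J.Icarr ideal_prod.prod frac_in_extensionI)
    qed auto
  qed
qed

lemma extension_ideal_prod_list:
  assumes "\<And>J. J \<in> set Js \<Longrightarrow> ideal J R"
  shows "extension (ideal_prod_list R Js) = ideal_prod_list L (map extension Js)"
proof -
  have "ideal (ideal_prod_list R Js) R \<and>
    extension (ideal_prod_list R Js) = ideal_prod_list L (map extension Js)"
    using assms
  proof (induction Js)
    case Nil
    show ?case by (simp add: ideal_prod_list_def oneideal extension_carrier)
  next
    case (Cons J Js)
    have J: "ideal J R" and Js: "ideal (ideal_prod_list R Js) R"
      and IH: "extension (ideal_prod_list R Js) = ideal_prod_list L (map extension Js)"
      using Cons by auto
    show ?case
      using ideal_prod_is_ideal[OF J Js] extension_ideal_prod[OF J Js] IH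
      by (simp add: ideal_prod_list_def)
  qed
  then show ?thesis ..
qed

lemma ideal_contraction:
  assumes K: "ideal K L"
  shows "ideal (contraction K) R"
proof (rule idealI[OF ring_axioms])
  interpret K: ideal K L by (rule K)
  have l_closed: "b \<otimes> a \<in> contraction K" if "a \<in> contraction K" "b \<in> carrier R" for a b
  proof -
    have "frac b \<one> \<otimes>\<^bsub>L\<^esub> frac a \<one> \<in> K"
      using that by (intro K.I_l_closed) (auto simp: contraction_def)
    then show ?thesis using that by (simp add: contraction_def)
  qed
  show "subgroup (contraction K) (add_monoid R)"
  proof (rule add.subgroupI)
    show "contraction K \<subseteq> carrier R"
      unfolding contraction_def by blast
    have "\<zero> \<in> contraction K"
      using K.zero_closed by (simp add: contraction_def zero_L)
    then show "contraction K \<noteq> {}" by blast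
    show "\<ominus> a \<in> contraction K" if "a \<in> contraction K" for a
      using l_closed[OF that, of "\<ominus> \<one>"] that by (simp add: contraction_def l_minus)
    show "a \<oplus> b \<in> contraction K" if "a \<in> contraction K" "b \<in> contraction K" for a b
      using that K.a_closed[of "frac a \<one>" "frac b \<one>"] by (simp add: contraction_def)
  qed
  show "b \<otimes> a \<in> contraction K" if "a \<in> contraction K" "b \<in> carrier R" for a b
    using that by (rule l_closed)
  show "a \<otimes> b \<in> contraction K" if "a \<in> contraction K" "b \<in> carrier R" for a b
    using l_closed[OF that] that by (simp add: m_comm contraction_def)
qed

text \<open>The numerator of any \<open>a/s \<in> K\<close> lies in the contraction, because \<open>a/1 = (s/1) (a/s)\<close>.\<close>

lemma extension_contraction:
  assumes K: "ideal K L"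
  shows "extension (contraction K) = K"
proof
  interpret K: ideal K L by (rule K)
  show "extension (contraction K) \<subseteq> K"
  proof
    fix x assume "x \<in> extension (contraction K)"
    then obtain a s where a: "a \<in> carrier R" "frac a \<one> \<in> K" "s \<in> S" "x = frac a s"
      unfolding extension_def contraction_def by blast
    have "frac \<one> s \<otimes>\<^bsub>L\<^esub> frac a \<one> \<in> K"
      using a by (intro K.I_l_closed) auto
    then show "x \<in> K" using a by simp
  qed
  show "K \<subseteq> extension (contraction K)"
  proof
    fix x assume x: "x \<in> K"
    then obtain a s where a: "a \<in> carrier R" "s \<in> S" "x = frac a s"
      using frac_cases K.Icarr by metis
    have "frac s \<one> \<otimes>\<^bsub>L\<^esub> x \<in> K"
      using x a by (intro K.I_l_closed) auto
    also have "frac s \<one> \<otimes>\<^bsub>L\<^esub> x = frac a \<one>"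
      unfolding a(3) using a(1,2) frac_eqI[of \<one> "s \<otimes> a" s a] by simp
    finally show "x \<in> extension (contraction K)"
      using a by (auto intro: frac_in_extensionI simp: contraction_def)
  qed
qed

lemma proper_contraction:
  assumes "proper_ideal L K"
  shows "proper_ideal R (contraction K)"
  using assms ideal_contraction extension_contraction extension_carrier
  unfolding proper_ideal_def by metis

section \<open>Extensions of \<open>n\<close>-OA ideals\<close>

text \<open>The factor from \<open>S\<close> that moves the product of the numerators into \<open>I\<close> is absorbed by the first
  numerator, which stays a nonunit. Since \<open>n \<ge> 1\<close>, the last numerator is untouched, and the factor
  only reappears in the product of the first \<open>n\<close>, where the extension ignores it.\<close>

lemma OA_ideal_extension:
  assumes n: "n \<ge> 1" and I: "OA_ideal n R I" and ne: "extension I \<noteq> carrier L"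
  shows "OA_ideal n L (extension I)"
  unfolding OA_ideal_def
proof (intro conjI ballI impI)
  have id: "ideal I R"
    using I unfolding OA_ideal_def proper_ideal_def by blast
  show "proper_ideal L (extension I)"
    unfolding proper_ideal_def using ne ideal_extension[OF id] by blast
  fix x
  assume x: "x \<in> {1..n + 1} \<rightarrow> carrier L - Units L"
    and prod: "(\<Otimes>\<^bsub>L\<^esub>i\<in>{1..n + 1}. x i) \<in> extension I"
  have ex_p: "\<forall>i\<in>{1..n + 1}. \<exists>p. fst p \<in> carrier R \<and> snd p \<in> S \<and> x i = frac (fst p) (snd p)"
  proof
    fix i assume "i \<in> {1..n + 1}"
    then have "x i \<in> carrier L"
      using x by auto
    then show "\<exists>p. fst p \<in> carrier R \<and> snd p \<in> S \<and> x i = frac (fst p) (snd p)"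
      by (elim frac_cases) (metis fst_conv snd_conv)
  qed
  obtain p where p: "\<And>i. i \<in> {1..n + 1} \<Longrightarrow>
      fst (p i) \<in> carrier R \<and> snd (p i) \<in> S \<and> x i = frac (fst (p i)) (snd (p i))"
    using bchoice[OF ex_p] by blast
  define a where "a = fst \<circ> p"
  define s where "s = snd \<circ> p"
  have a: "a i \<in> carrier R" and s: "s i \<in> S" and xf: "x i = frac (a i) (s i)"
    if "i \<in> {1..n + 1}" for i
    using p[OF that] unfolding a_def s_def by auto
  have finprod_x: "(\<Otimes>\<^bsub>L\<^esub>i\<in>{1..m}. x i) = frac (\<Otimes>i\<in>{1..m}. a i) (\<Otimes>i\<in>{1..m}. s i)"
    and finprod_a: "(\<Otimes>i\<in>{1..m}. a i) \<in> carrier R" and finprod_s: "(\<Otimes>i\<in>{1..m}. s i) \<in> S"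
    if "m \<le> n + 1" for m
  proof -
    have as: "a \<in> {1..m} \<rightarrow> carrier R" "s \<in> {1..m} \<rightarrow> S"
      using that a s by auto
    have "(\<Otimes>\<^bsub>L\<^esub>i\<in>{1..m}. x i) = (\<Otimes>\<^bsub>L\<^esub>i\<in>{1..m}. frac (a i) (s i))"
      using that as xf by (intro L.finprod_cong') (auto simp: Pi_iff)
    then show "(\<Otimes>\<^bsub>L\<^esub>i\<in>{1..m}. x i) = frac (\<Otimes>i\<in>{1..m}. a i) (\<Otimes>i\<in>{1..m}. s i)"
      using as by (simp add: finprod_frac)
    show "(\<Otimes>i\<in>{1..m}. a i) \<in> carrier R"
      using as by simp
    show "(\<Otimes>i\<in>{1..m}. s i) \<in> S"
      using as by (simp add: finprod_S)
  qed
  have nonunit: "a i \<notin> Units R" if "i \<in> {1..n + 1}" for i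
  proof
    assume "a i \<in> Units R"
    then have "x i \<in> Units L"
      unfolding xf[OF that] using s[OF that] by (rule frac_Units)
    then show False
      using x that by blast
  qed
  obtain u where u: "u \<in> S" "u \<otimes> (\<Otimes>i\<in>{1..n + 1}. a i) \<in> I"
    using prod unfolding finprod_x[OF order_refl]
      frac_in_extension_iff[OF id finprod_a[OF order_refl] finprod_s[OF order_refl]]
    by blast
  define b where "b = a(1 := u \<otimes> a 1)"
  have finprod_b: "(\<Otimes>i\<in>{1..m}. b i) = u \<otimes> (\<Otimes>i\<in>{1..m}. a i)" if m: "1 \<le> m" "m \<le> n + 1" for m
  proof -
    have *: "{1..m} = insert 1 {2..m}"
      using m by auto
    have c: "a \<in> {2..m} \<rightarrow> carrier R" "a 1 \<in> carrier R"
      using m a by auto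
    have "(\<Otimes>i\<in>{2..m}. b i) = (\<Otimes>i\<in>{2..m}. a i)"
      using c by (intro finprod_cong') (auto simp: b_def)
    moreover have "b \<in> {2..m} \<rightarrow> carrier R" "b 1 = u \<otimes> a 1"
      using c by (auto simp: b_def)
    ultimately show ?thesis
      unfolding * using c u by (simp add: m_assoc)
  qed
  have b: "b \<in> {1..n + 1} \<rightarrow> carrier R - Units R"
  proof
    fix i assume i: "i \<in> {1..n + 1}"
    have "u \<otimes> a 1 \<notin> Units R"
      using unit_factor[of "a 1" u] nonunit[of 1] a[of 1] u by (auto simp: m_comm)
    then show "b i \<in> carrier R - Units R"
      using i a nonunit u by (auto simp: b_def)
  qed
  have "(\<Otimes>i\<in>{1..n + 1}. b i) \<in> I"
    using u finprod_b[of "n + 1"] by simp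
  then have "(\<Otimes>i\<in>{1..n}. b i) \<in> I \<or> b (n + 1) \<in> I"
    using I b unfolding OA_ideal_def by blast
  then show "(\<Otimes>\<^bsub>L\<^esub>i\<in>{1..n}. x i) \<in> extension I \<or> x (n + 1) \<in> extension I"
  proof
    assume "(\<Otimes>i\<in>{1..n}. b i) \<in> I"
    then have "\<exists>u\<in>S. u \<otimes> (\<Otimes>i\<in>{1..n}. a i) \<in> I"
      using u n finprod_b[of n] by auto
    then show ?thesis
      using frac_in_extension_iff[OF id finprod_a finprod_s, of n n] finprod_x[of n] by simp
  next
    assume "b (n + 1) \<in> I"
    then have "a (n + 1) \<in> I"
      using n by (simp add: b_def)
    then show ?thesis
      using xf[of "n + 1"] s[of "n + 1"] frac_in_extensionI by simp
  qed
qed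

end

section \<open>Localization of \<open>n\<close>-OAF-rings\<close>

text \<open>The ideals \<open>J\<close> that meet \<open>S\<close> extend to the whole ring, which is not an \<open>n\<close>-OA ideal. It is the
  identity of ideal multiplication, so these factors can be left out.\<close>

lemma (in cring) ideal_prod_list_filter_proper:
  assumes "\<And>J. J \<in> set Js \<Longrightarrow> ideal J R"
  shows "ideal_prod_list R (filter (\<lambda>J. J \<noteq> carrier R) Js) = ideal_prod_list R Js"
proof -
  have "ideal (ideal_prod_list R Js) R \<and>
    ideal_prod_list R (filter (\<lambda>J. J \<noteq> carrier R) Js) = ideal_prod_list R Js"
    using assms
  proof (induction Js)
    case Nil
    show ?case by (simp add: ideal_prod_list_def oneideal)
  next
    case (Cons J Js)
    have J: "ideal J R" and Js: "ideal (ideal_prod_list R Js) R"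
      using Cons by auto
    have "ideal_prod R (carrier R) (ideal_prod_list R Js) = ideal_prod_list R Js"
      using ideal_prod_one[OF Js] ideal_prod_commute[OF oneideal Js] by simp
    then show ?case
      using Cons J Js by (auto simp: ideal_prod_list_def ideal_prod_is_ideal)
  qed
  then show ?thesis ..
qed

lemma (in ring_of_fractions) OAF_ring_L:
  assumes n: "n \<ge> 1" and R: "OAF_ring n R"
  shows "OAF_ring n L"
  unfolding OAF_ring_def
proof (intro conjI allI impI nonzero_cring_L)
  fix K assume K: "proper_ideal L K"
  then obtain Js where Js: "\<And>J. J \<in> set Js \<Longrightarrow> OA_ideal n R J"
      "contraction K = ideal_prod_list R Js"
    using R proper_contraction unfolding OAF_ring_def by metis
  then have id: "\<And>J. J \<in> set Js \<Longrightarrow> ideal J R"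
    unfolding OA_ideal_def proper_ideal_def by blast
  have "K = extension (ideal_prod_list R Js)"
    using K extension_contraction Js(2) unfolding proper_ideal_def by metis
  also have "\<dots> = ideal_prod_list L (map extension Js)"
    using id by (rule extension_ideal_prod_list)
  also have "\<dots> = ideal_prod_list L (filter (\<lambda>J. J \<noteq> carrier L) (map extension Js))"
    using id ideal_extension by (intro L.ideal_prod_list_filter_proper[symmetric]) auto
  finally show "\<exists>Ks. (\<forall>J\<in>set Ks. OA_ideal n L J) \<and> K = ideal_prod_list L Ks"
    using Js(1) OA_ideal_extension[OF n]
    by (intro exI[of _ "filter (\<lambda>J. J \<noteq> carrier L) (map extension Js)"]) auto
qed

theorem proposition2p12:
  fixes R :: "('a, 'm) ring_scheme" and n :: nat
  assumes "n \<ge> 1" and "nonzero_cring R" and "OAF_ring n R"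
  shows "(\<forall>S. mult_closed_set R S \<longrightarrow> OAF_ring n (localization R S)) \<and>
         (\<forall>M. maximalideal M R \<longrightarrow> OAF_ring n (localization_at R M))"
proof -
  interpret nonzero_cring R by (rule assms(2))
  have loc: "OAF_ring n (localization R S)" if "mult_closed_set R S" for S
  proof -
    interpret ring_of_fractions R S
      by unfold_locales (rule that)
    show ?thesis
      using assms(1,3) by (rule OAF_ring_L)
  qed
  then show ?thesis
    using mult_closed_set_compl_maximalideal by blast
qed

end
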